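(* Let $\Pi=\mathbb{R}/\mathbb{Z}$ be the circle, let $a,b\in C^0(\Pi)$ with $a>0$, and assume that $b$ is separated from $0$ on $\Pi$ (i.e. $b(x)\ne0$ for all $x\in\Pi$). Set $$\omega(s):=\frac{1}{b(s)}\Big/\int_0^1\frac{1}{b(u)}\,du .$$ Then for every probability measure $\mu$ on $\Pi$, $$J(\mu)=\begin{cases}0&\text{if }\mu=\omega\,ds,\\ +\infty&\text{otherwise.}\end{cases}$$
   Context: For $c\in C^0(\Pi)$ and $\epsilon>0$, let $\lambda_\epsilon^c$ be the principal eigenvalue (the eigenvalue with maximal real part) of the operator $u\mapsto\epsilon\,a\,u''+b\,u'+c\,u$ on $\Pi$. Let $\Lambda(c):=\lim_{\epsilon\to0}\lambda_\epsilon^c$ (this limit exists under the present assumptions). For a probability measure $\mu$ on $\Pi$, $$J(\mu):=\sup_{c\in C^0(\Pi)}\Bigl\{\int_\Pi c\,d\mu-\Lambda(c)\Bigr\}.$$ *)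

theory Defs
  imports "HOL-Probability.Probability"
begin

text \<open>
  Functions on the circle R/Z are represented by their 1-periodic lifts to the real line.
\<close>

definition C0_circle :: "(real \<Rightarrow> 'a::topological_space) set" where
  "C0_circle = {f. continuous_on UNIV f \<and> (\<forall>x. f (x + 1) = f x)}"

definition deriv1 :: "(real \<Rightarrow> complex) \<Rightarrow> real \<Rightarrow> complex" where
  "deriv1 u x = vector_derivative u (at x)"

definition C2_circle :: "(real \<Rightarrow> complex) set" where
  "C2_circle = {u \<in> C0_circle.
     (\<forall>x. u differentiable (at x)) \<and>
     (\<forall>x. deriv1 u differentiable (at x)) \<and>
     continuous_on UNIV (deriv1 (deriv1 u))}"

definition circle_op ::
  "(real \<Rightarrow> real) \<Rightarrow> (real \<Rightarrow> real) \<Rightarrow> (real \<Rightarrow> real) \<Rightarrow> real \<Rightarrow> (real \<Rightarrow> complex) \<Rightarrow> real \<Rightarrow> complex" where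
  "circle_op a b c \<epsilon> u x =
     of_real (\<epsilon> * a x) * deriv1 (deriv1 u) x + of_real (b x) * deriv1 u x + of_real (c x) * u x"

definition is_eigenvalue ::
  "(real \<Rightarrow> real) \<Rightarrow> (real \<Rightarrow> real) \<Rightarrow> (real \<Rightarrow> real) \<Rightarrow> real \<Rightarrow> complex \<Rightarrow> bool" where
  "is_eigenvalue a b c \<epsilon> l \<longleftrightarrow>
     (\<exists>u \<in> C2_circle. (\<exists>x. u x \<noteq> 0) \<and> (\<forall>x. circle_op a b c \<epsilon> u x = l * u x))"

text \<open>
  The spectrum is complex in general, but for \<open>a > 0\<close> and \<open>\<epsilon> > 0\<close> the eigenvalue with maximal
  real part is itself real (Krein--Rutman), hence the real-valued description.
\<close>

definition principal_eigenvalue ::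
  "(real \<Rightarrow> real) \<Rightarrow> (real \<Rightarrow> real) \<Rightarrow> (real \<Rightarrow> real) \<Rightarrow> real \<Rightarrow> real" where
  "principal_eigenvalue a b c \<epsilon> =
     (THE r. is_eigenvalue a b c \<epsilon> (of_real r) \<and> (\<forall>l. is_eigenvalue a b c \<epsilon> l \<longrightarrow> Re l \<le> r))"

definition Lambda :: "(real \<Rightarrow> real) \<Rightarrow> (real \<Rightarrow> real) \<Rightarrow> (real \<Rightarrow> real) \<Rightarrow> real" where
  "Lambda a b c = Lim (at_right 0) (\<lambda>\<epsilon>. principal_eigenvalue a b c \<epsilon>)"

text \<open>
  The quotient map restricts to a Borel isomorphism from the fundamental domain \<open>{0..<1}\<close> onto
  R/Z, so Borel measures on the circle are measures on \<open>{0..<1}\<close> with its Borel sets; an integral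
  over the circle is the integral of the lift.
\<close>

definition prob_measure_circle :: "real measure \<Rightarrow> bool" where
  "prob_measure_circle \<mu> \<longleftrightarrow>
     prob_space \<mu> \<and> sets \<mu> = sets (restrict_space borel {0..<1::real})"

definition J :: "(real \<Rightarrow> real) \<Rightarrow> (real \<Rightarrow> real) \<Rightarrow> real measure \<Rightarrow> ereal" where
  "J a b \<mu> = (SUP c \<in> C0_circle. ereal ((\<integral>x. c x \<partial>\<mu>) - Lambda a b c))"

definition omega :: "(real \<Rightarrow> real) \<Rightarrow> real \<Rightarrow> real" where
  "omega b s = (1 / b s) / (LBINT u:{0..1}. 1 / b u)"

definition omega_measure :: "(real \<Rightarrow> real) \<Rightarrow> real measure" where
  "omega_measure b = density (restrict_space lborel {0..<1}) (\<lambda>s. ennreal (omega b s))"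

end

theory Submission
  imports Defs
begin

text \<open>
  Writing a positive eigenfunction as \<open>exp P\<close> and \<open>p = P'\<close>, the eigenvalue equation becomes
  \<open>\<epsilon> a p' + b p = \<lambda> - c - \<epsilon> a p\<^sup>2\<close> with \<open>p\<close> of mean zero. The maximum principle bounds \<open>\<lambda>\<close> and \<open>p\<close>
  by the supremum norm of the right-hand side without \<open>\<lambda>\<close>, uniformly in \<open>\<epsilon>\<close>, because \<open>b\<close> has a sign;
  so for small \<open>\<epsilon>\<close> a contraction produces \<open>p\<close> and \<open>\<lambda>\<close>, and \<open>\<lambda>\<close> is principal since its
  eigenfunction is positive. As \<open>\<epsilon>\<close> tends to 0, \<open>p\<close> tends to \<open>(\<lambda> - c) / b\<close>, whose mean must vanish:
  this gives \<open>\<Lambda>(c) = \<integral> c \<omega>\<close>. Since \<open>\<Lambda>\<close> is linear, the supremum of the linear functional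
  \<open>\<integral> c d\<mu> - \<Lambda>(c)\<close> is \<open>0\<close> or \<open>\<infinity>\<close>.
\<close>

section \<open>Periodic functions\<close>

lemma C0_circle_continuous: "f \<in> C0_circle \<Longrightarrow> continuous_on S f"
  unfolding C0_circle_def using continuous_on_subset by blast

lemma C0_circle_periodic: "f \<in> C0_circle \<Longrightarrow> f (x + 1) = f x"
  unfolding C0_circle_def by blast

lemma C0_circle_frac:
  assumes "f \<in> C0_circle"
  shows "f (frac x) = f x"
proof -
  have nat: "f (y + real n) = f y" for y n
  proof (induction n)
    case (Suc n)
    have "f (y + real (Suc n)) = f ((y + real n) + 1)" by (simp add: algebra_simps)
    then show ?case using Suc C0_circle_periodic[OF assms] by metis
  qed simp
  show ?thesis
  proof (cases "\<lfloor>x\<rfloor> \<ge> 0")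
    case True
    then have "x = frac x + real (nat \<lfloor>x\<rfloor>)" by (simp add: frac_def)
    then show ?thesis using nat by metis
  next
    case False
    then have "frac x = x + real (nat (- \<lfloor>x\<rfloor>))" by (simp add: frac_def)
    then show ?thesis using nat by metis
  qed
qed

lemma C0_circle_attains_sup:
  fixes f :: "real \<Rightarrow> real"
  assumes "f \<in> C0_circle"
  obtains x0 where "\<And>x. f x \<le> f x0"
proof -
  have "\<exists>x0\<in>{0..1}. \<forall>x\<in>{0..1}. f x \<le> f x0"
    using C0_circle_continuous[OF assms] by (intro continuous_attains_sup) auto
  then obtain x0 where x0: "\<And>x. x \<in> {0..1} \<Longrightarrow> f x \<le> f x0" by blast
  have "f x \<le> f x0" for x
    using x0[of "frac x"] C0_circle_frac[OF assms] frac_lt_1[of x] by simp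
  then show ?thesis by (rule that)
qed

lemma C0_circle_uminus:
  fixes f :: "real \<Rightarrow> real"
  shows "f \<in> C0_circle \<Longrightarrow> (\<lambda>x. - f x) \<in> C0_circle"
  by (auto simp: C0_circle_def intro!: continuous_intros)

lemma C0_circle_attains_inf:
  fixes f :: "real \<Rightarrow> real"
  assumes "f \<in> C0_circle"
  obtains x0 where "\<And>x. f x0 \<le> f x"
  using C0_circle_attains_sup[OF C0_circle_uminus[OF assms]] by auto

lemma C0_circle_bounded:
  fixes f :: "real \<Rightarrow> real"
  assumes "f \<in> C0_circle"
  obtains M where "M > 0" "\<And>x. \<bar>f x\<bar> \<le> M"
proof -
  have "(\<lambda>x. \<bar>f x\<bar>) \<in> C0_circle"
    using assms by (auto simp: C0_circle_def intro!: continuous_intros)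
  then obtain x0 where x0: "\<And>x. \<bar>f x\<bar> \<le> \<bar>f x0\<bar>" by (rule C0_circle_attains_sup) blast
  show ?thesis
  proof (rule that[of "\<bar>f x0\<bar> + 1"])
    show "\<bar>f x\<bar> \<le> \<bar>f x0\<bar> + 1" for x using x0[of x] by simp
  qed simp
qed

text \<open>Continuity rules out a change of sign. The extrema are attained because one period is
  compact, so the nearer extremum gives a uniform gap \<open>\<beta>\<close>.\<close>

lemma C0_circle_sign:
  assumes "b \<in> C0_circle" and "\<And>x. b x \<noteq> (0::real)"
  obtains \<beta> where "\<beta> > 0" "(\<forall>x. \<beta> \<le> b x) \<or> (\<forall>x. b x \<le> - \<beta>)"
proof -
  obtain x0 where x0: "\<And>x. b x \<le> b x0" using C0_circle_attains_sup[OF assms(1)] by blast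
  obtain x1 where x1: "\<And>x. b x1 \<le> b x" using C0_circle_attains_inf[OF assms(1)] by blast
  have iv: "is_interval (range b)"
    using C0_circle_continuous[OF assms(1)] connected_continuous_image connected_UNIV
      is_interval_connected_1 by blast
  have "\<not> (b x1 < 0 \<and> 0 < b x0)"
  proof
    assume "b x1 < 0 \<and> 0 < b x0"
    then have "0 \<in> range b"
      using iv mem_is_interval_1_I[of "range b" "b x1" "b x0" 0] by auto
    then show False using assms(2) by (metis rangeE)
  qed
  then consider "0 < b x1" | "b x0 < 0" using assms(2)[of x0] assms(2)[of x1] by linarith
  then show ?thesis
  proof cases
    case 1 then show ?thesis using x1 that by blast
  next
    case 2 then show ?thesis using x0 that[of "- b x0"] by simp
  qed
qed

section \<open>Antiderivatives of periodic functions\<close>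

lemma antiderivative_UNIV:
  fixes f :: "real \<Rightarrow> real"
  assumes "continuous_on UNIV f"
  obtains F where "\<And>x. (F has_real_derivative f x) (at x)"
proof -
  have "\<exists>F. \<forall>x::real. -\<infinity> < ereal x \<longrightarrow> ereal x < \<infinity> \<longrightarrow> (F has_vector_derivative f x) (at x)"
    using assms by (intro einterval_antiderivative) (auto simp: continuous_on_eq_continuous_at)
  then show ?thesis using that by (auto simp: has_real_derivative_iff_has_vector_derivative)
qed

text \<open>\<open>F\<close> may drift, but its increment over one period has derivative
  \<open>f (x + 1) - f x = 0\<close>. Hence equality of \<open>F\<close> at 0 and 1 already makes
  \<open>F\<close> periodic.\<close>

lemma periodic_antiderivative:
  fixes F f :: "real \<Rightarrow> real"
  assumes F: "\<And>x. (F has_real_derivative f x) (at x)"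
    and f: "\<And>x. f (x + 1) = f x"
  shows "F (x + 1) - F x = F 1 - F 0"
proof -
  have "((\<lambda>x. F (x + 1) - F x) has_real_derivative 0) (at x)" for x
  proof -
    have "((\<lambda>x. F (x + 1)) has_real_derivative f (x + 1)) (at x)"
      using F[of "x + 1"] DERIV_shift[of F] by blast
    from DERIV_diff[OF this F[of x]] show ?thesis by (simp add: f)
  qed
  then show ?thesis using DERIV_isconst_all[of "\<lambda>x. F (x + 1) - F x" x 0] by simp
qed

lemma antiderivative_in_C0_circle:
  fixes F f :: "real \<Rightarrow> real"
  assumes F: "\<And>x. (F has_real_derivative f x) (at x)"
    and f: "\<And>x. f (x + 1) = f x" and "F 1 = F 0"
  shows "F \<in> C0_circle"
proof -
  have "continuous_on UNIV F"
    using F by (meson DERIV_isCont continuous_at_imp_continuous_on)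
  then show ?thesis
    using periodic_antiderivative[OF F f] assms(3) by (auto simp: C0_circle_def)
qed

section \<open>Derivative tests at global extrema\<close>

lemma derivative_at_max:
  fixes f :: "real \<Rightarrow> real"
  assumes "(f has_real_derivative D) (at x0)" "\<And>x. f x \<le> f x0"
  shows "D = 0"
  using DERIV_local_max[OF assms(1), of 1] assms(2) by auto

lemma derivative_at_min:
  fixes f :: "real \<Rightarrow> real"
  assumes "(f has_real_derivative D) (at x0)" "\<And>x. f x0 \<le> f x"
  shows "D = 0"
  using DERIV_local_min[OF assms(1), of 1] assms(2) by auto

text \<open>If \<open>D\<close> were negative, \<open>f'\<close> would pass from 0 to negative
  values immediately to the right of the minimum, and the mean value theorem would push
  \<open>f\<close> below it.\<close>

lemma second_derivative_at_min:
  fixes f f' :: "real \<Rightarrow> real"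
  assumes f: "\<And>x. (f has_real_derivative f' x) (at x)"
    and f': "(f' has_real_derivative D) (at x0)"
    and min: "\<And>x. f x0 \<le> f x"
  shows "D \<ge> 0"
proof (rule ccontr)
  assume "\<not> D \<ge> 0"
  then have "D < 0" by simp
  from DERIV_neg_dec_right[OF f' this] obtain d where
    d: "d > 0" "\<And>h. 0 < h \<Longrightarrow> h < d \<Longrightarrow> f' x0 > f' (x0 + h)" by blast
  have f'0: "f' x0 = 0" by (rule derivative_at_min[OF f min])
  obtain z where z: "x0 < z" "z < x0 + d / 2" "f (x0 + d / 2) - f x0 = (d / 2) * f' z"
    using MVT2[of x0 "x0 + d / 2" f f'] f d(1) by auto
  have "f' z < 0" using d(2)[of "z - x0"] z d(1) f'0 by auto
  then have "f (x0 + d / 2) < f x0"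
    using z(3) d(1) mult_pos_neg[of "d / 2" "f' z"] by linarith
  then show False using min[of "x0 + d / 2"] by simp
qed

section \<open>The linear periodic problem\<close>

text \<open>This is \<open>\<alpha> p' + b p = l - h\<close>, solved for \<open>p'\<close>. The
  periodic antiderivative \<open>P\<close> encodes that \<open>p\<close> has mean zero, and the
  constant \<open>l\<close> is an unknown that pays for this constraint.\<close>

definition cell_problem ::
  "(real \<Rightarrow> real) \<Rightarrow> (real \<Rightarrow> real) \<Rightarrow> (real \<Rightarrow> real) \<Rightarrow> real \<Rightarrow> (real \<Rightarrow> real) \<Rightarrow> (real \<Rightarrow> real) \<Rightarrow> bool"
  where "cell_problem \<alpha> b h l p P \<longleftrightarrow> P \<in> C0_circle \<and> p \<in> C0_circle \<and>
    (\<forall>x. (P has_real_derivative p x) (at x)) \<and>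
    (\<forall>x. (p has_real_derivative (l - h x - b x * p x) / \<alpha> x) (at x))"

text \<open>Linearity lets the a priori bounds be applied to differences, which gives both the
  contraction estimate and the convergence of the eigenvalues.\<close>

lemma cell_problem_diff:
  assumes "cell_problem \<alpha> b h l p P" "cell_problem \<alpha> b k m q Q"
  shows "cell_problem \<alpha> b (\<lambda>x. h x - k x) (l - m) (\<lambda>x. p x - q x) (\<lambda>x. P x - Q x)"
proof -
  have "((\<lambda>x. p x - q x) has_real_derivative
      (l - m - (h x - k x) - b x * (p x - q x)) / \<alpha> x) (at x)" for x
  proof -
    have "((\<lambda>x. p x - q x) has_real_derivative
      (l - h x - b x * p x) / \<alpha> x - (m - k x - b x * q x) / \<alpha> x) (at x)"
      using assms by (intro DERIV_diff) (auto simp: cell_problem_def)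
    then show ?thesis by (simp add: diff_divide_distrib[symmetric] algebra_simps)
  qed
  then show ?thesis
    using assms by (auto simp: cell_problem_def C0_circle_def intro!: continuous_intros DERIV_diff)
qed

text \<open>At an extremum of \<open>p\<close> the derivative drops out and leaves
  \<open>b p = l - h\<close>. Mean zero and the sign of \<open>b\<close> then trap \<open>l\<close>
  between two values of \<open>h\<close>. Neither bound involves \<alpha>, so they are uniform in
  the diffusion.\<close>

lemma cell_problem_bounds:
  assumes sol: "cell_problem \<alpha> b h l p P"
    and \<alpha>: "\<And>x. \<alpha> x > 0"
    and b: "(\<forall>x. \<beta> \<le> b x) \<or> (\<forall>x. b x \<le> - \<beta>)" and \<beta>: "\<beta> > 0"
    and h: "\<And>x. \<bar>h x\<bar> \<le> H"
  shows "\<bar>l\<bar> \<le> H" and "\<bar>p x\<bar> \<le> 2 * H / \<beta>"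
proof -
  note sol = sol[unfolded cell_problem_def]
  have p: "p \<in> C0_circle" using sol by blast
  obtain x0 where x0: "\<And>x. p x \<le> p x0" using C0_circle_attains_sup[OF p] by blast
  obtain x1 where x1: "\<And>x. p x1 \<le> p x" using C0_circle_attains_inf[OF p] by blast
  have "(l - h x0 - b x0 * p x0) / \<alpha> x0 = 0" "(l - h x1 - b x1 * p x1) / \<alpha> x1 = 0"
    using derivative_at_max[of p _ x0] derivative_at_min[of p _ x1] sol x0 x1 by blast+
  then have eq: "b x0 * p x0 = l - h x0" "b x1 * p x1 = l - h x1"
    using \<alpha>[of x0] \<alpha>[of x1] by (simp_all)
  \<comment> \<open>Periodicity of \<open>P\<close> forces a zero of \<open>p\<close>, so the
    maximum of \<open>p\<close> is nonnegative and its minimum nonpositive.\<close>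
  obtain z where z: "P 1 - P 0 = (1 - 0) * p z"
    using MVT2[of 0 1 P p] sol by auto
  moreover have "P 1 = P 0" using C0_circle_periodic[of P 0] sol by simp
  ultimately have "p z = 0" by simp
  then have sgn: "p x0 \<ge> 0" "p x1 \<le> 0" using x0[of z] x1[of z] by auto
  show l: "\<bar>l\<bar> \<le> H"
    using b
  proof
    assume "\<forall>x. \<beta> \<le> b x"
    then have "b x0 \<ge> 0" "b x1 \<ge> 0" using \<beta> by (smt (verit))+
    then have "b x0 * p x0 \<ge> 0" "b x1 * p x1 \<le> 0"
      using sgn by (auto intro!: mult_nonneg_nonneg mult_nonneg_nonpos)
    then show ?thesis using eq h[of x0] h[of x1] by linarith
  next
    assume "\<forall>x. b x \<le> - \<beta>"
    then have "b x0 \<le> 0" "b x1 \<le> 0" using \<beta> by (smt (verit))+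
    then have "b x0 * p x0 \<le> 0" "b x1 * p x1 \<ge> 0"
      using sgn by (auto intro!: mult_nonpos_nonneg mult_nonpos_nonpos)
    then show ?thesis using eq h[of x0] h[of x1] by linarith
  qed
  have est: "\<bar>p y\<bar> \<le> 2 * H / \<beta>" if "b y * p y = l - h y" for y
  proof -
    have "\<beta> * \<bar>p y\<bar> \<le> \<bar>b y\<bar> * \<bar>p y\<bar>"
      using b \<beta> by (intro mult_right_mono) (smt (verit), simp)
    also have "\<dots> \<le> 2 * H"
      using l h[of y] that by (simp flip: abs_mult)
    finally show ?thesis using \<beta> by (simp add: field_simps)
  qed
  show "\<bar>p x\<bar> \<le> 2 * H / \<beta>"
    using est[OF eq(1)] est[OF eq(2)] x0[of x] x1[of x] by linarith
qed

text \<open>The constant of integration \<open>C\<close> is chosen such that the solution takes the same value at 0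
  and 1; this is possible because \<open>b\<close> has a sign, so that \<open>exp (B 1) \<noteq> exp (B 0)\<close>.\<close>

lemma periodic_linear_ode:
  assumes \<alpha>: "\<alpha> \<in> C0_circle" "\<And>x. \<alpha> x > 0" and b: "b \<in> C0_circle" "\<And>x. b x \<noteq> 0"
    and h: "h \<in> C0_circle"
  obtains p where "p \<in> C0_circle" "\<And>x. (p has_real_derivative (h x - b x * p x) / \<alpha> x) (at x)"
proof -
  have \<alpha>0: "\<alpha> x \<noteq> 0" for x using \<alpha>(2)[of x] by simp
  have "continuous_on UNIV (\<lambda>x. b x / \<alpha> x)"
    using \<alpha>0 by (intro continuous_intros C0_circle_continuous \<alpha> b) auto
  then obtain B where B: "\<And>x. (B has_real_derivative b x / \<alpha> x) (at x)"
    using antiderivative_UNIV by blast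
  have contB: "continuous_on UNIV B"
    using B by (meson DERIV_isCont continuous_at_imp_continuous_on)
  have "continuous_on UNIV (\<lambda>x. exp (B x) * h x / \<alpha> x)"
    using \<alpha>0 by (intro continuous_intros C0_circle_continuous \<alpha> h contB) auto
  then obtain G where G: "\<And>x. (G has_real_derivative exp (B x) * h x / \<alpha> x) (at x)"
    using antiderivative_UNIV by blast
  obtain z where "B 1 - B 0 = (1 - 0) * (b z / \<alpha> z)"
    using MVT2[of 0 1 B "\<lambda>x. b x / \<alpha> x"] B by auto
  then have B10: "exp (B 1) - exp (B 0) \<noteq> 0" using b(2)[of z] \<alpha>0[of z] by auto
  define C where "C = (exp (B 0) * G 1 - exp (B 1) * G 0) / (exp (B 1) - exp (B 0))"
  \<comment> \<open>Variation of constants with integrating factor \<open>exp (B x)\<close>.\<close>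
  define p where "p = (\<lambda>x. exp (- B x) * (C + G x))"
  have p': "(p has_real_derivative (h x - b x * p x) / \<alpha> x) (at x)" for x
  proof -
    have "(p has_real_derivative
      exp (- B x) * - (b x / \<alpha> x) * (C + G x) + exp (- B x) * (exp (B x) * h x / \<alpha> x)) (at x)"
      unfolding p_def by (rule derivative_eq_intros B G refl | simp)+
    also have "exp (- B x) * (exp (B x) * h x / \<alpha> x) = h x / \<alpha> x"
      by (simp add: exp_minus)
    finally show ?thesis by (simp add: p_def diff_divide_distrib field_simps)
  qed
  have "C * (exp (B 1) - exp (B 0)) = exp (B 0) * G 1 - exp (B 1) * G 0"
    using B10 by (simp add: C_def)
  then have "exp (B 0) * (C + G 1) = exp (B 1) * (C + G 0)" by (simp add: algebra_simps)
  then have p01: "p 1 = p 0" unfolding p_def by (simp add: exp_minus field_simps)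
  \<comment> \<open>The difference of \<open>p\<close> and its translate solves the homogeneous
    equation, so multiplied by the integrating factor it is constant. It vanishes at 0, which makes
    \<open>p\<close> periodic.\<close>
  define d where "d x = exp (B x) * (p (x + 1) - p x)" for x
  have "(d has_real_derivative 0) (at x)" for x
  proof -
    have "((\<lambda>x. p (x + 1)) has_real_derivative (h x - b x * p (x + 1)) / \<alpha> x) (at x)"
      using p'[of "x + 1"] DERIV_shift[of p]
      by (simp add: C0_circle_periodic[OF h] C0_circle_periodic[OF b(1)] C0_circle_periodic[OF \<alpha>(1)])
    note ptrans = this
    have "(d has_real_derivative exp (B x) * (b x / \<alpha> x) * (p (x + 1) - p x) +
       exp (B x) * ((h x - b x * p (x + 1)) / \<alpha> x - (h x - b x * p x) / \<alpha> x)) (at x)"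
      unfolding d_def by (rule derivative_eq_intros B ptrans p' refl | simp)+
    then show ?thesis by (simp add: diff_divide_distrib algebra_simps)
  qed
  then have "d x = d 0" for x using DERIV_isconst_all[of d x 0] by blast
  then have "d x = 0" for x using p01 unfolding d_def by simp
  then have "p (x + 1) = p x" for x unfolding d_def by simp
  moreover have "continuous_on UNIV p"
    using p' by (meson DERIV_isCont continuous_at_imp_continuous_on)
  ultimately have "p \<in> C0_circle" by (simp add: C0_circle_def)
  then show ?thesis using that p' by blast
qed

text \<open>Superposition: \<open>e\<close> is the periodic response to the constant 1 and
  \<open>r\<close> the response to \<open>h\<close>. The combination \<open>l * e - r\<close> solves
  the equation for every \<open>l\<close>, and \<open>l\<close> can be tuned to remove the mean
  because \<open>e\<close> has no zero.\<close>

lemma cell_problem_exists: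
  assumes \<alpha>: "\<alpha> \<in> C0_circle" "\<And>x. \<alpha> x > 0" and b: "b \<in> C0_circle" "\<And>x. b x \<noteq> 0"
    and h: "h \<in> C0_circle"
  obtains l p P where "cell_problem \<alpha> b h l p P"
proof -
  have one: "(\<lambda>x. 1) \<in> C0_circle" by (simp add: C0_circle_def)
  obtain e where e: "e \<in> C0_circle" "\<And>x. (e has_real_derivative (1 - b x * e x) / \<alpha> x) (at x)"
    using periodic_linear_ode[OF \<alpha> b one] by blast
  obtain r where r: "r \<in> C0_circle" "\<And>x. (r has_real_derivative (h x - b x * r x) / \<alpha> x) (at x)"
    using periodic_linear_ode[OF \<alpha> b h] by blast
  obtain E where E: "\<And>x. (E has_real_derivative e x) (at x)"
    using antiderivative_UNIV[OF C0_circle_continuous[OF e(1)]] by blast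
  obtain R where R: "\<And>x. (R has_real_derivative r x) (at x)"
    using antiderivative_UNIV[OF C0_circle_continuous[OF r(1)]] by blast
  obtain \<beta> where \<beta>: "\<beta> > 0" "(\<forall>x. \<beta> \<le> b x) \<or> (\<forall>x. b x \<le> - \<beta>)"
    using C0_circle_sign[OF b] by blast
  \<comment> \<open>At its extrema \<open>e\<close> equals \<open>1 / b\<close>, so its maximum and
    minimum both have the sign of \<open>b\<close>.\<close>
  obtain x0 where x0: "\<And>x. e x \<le> e x0" using C0_circle_attains_sup[OF e(1)] by blast
  obtain x1 where x1: "\<And>x. e x1 \<le> e x" using C0_circle_attains_inf[OF e(1)] by blast
  have "(1 - b x0 * e x0) / \<alpha> x0 = 0" "(1 - b x1 * e x1) / \<alpha> x1 = 0"
    using derivative_at_max[OF e(2) x0] derivative_at_min[OF e(2) x1] by blast+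
  then have "e x0 = 1 / b x0" "e x1 = 1 / b x1"
    using \<alpha>(2)[of x0] \<alpha>(2)[of x1] b(2)[of x0] b(2)[of x1] by (simp_all add: field_simps)
  then have e_nz: "e x \<noteq> 0" for x
    using \<beta> x0[of x] x1[of x] divide_pos_pos[of 1 "b x1"] divide_pos_neg[of 1 "b x0"]
    by (smt (verit))
  obtain z where "E 1 - E 0 = (1 - 0) * e z" using MVT2[of 0 1 E e] E by auto
  then have E10: "E 1 - E 0 \<noteq> 0" using e_nz[of z] by simp
  define l where "l = (R 1 - R 0) / (E 1 - E 0)"
  define p where "p x = l * e x - r x" for x
  define P where "P x = l * E x - R x" for x
  have P: "(P has_real_derivative p x) (at x)" for x
    unfolding P_def p_def by (rule derivative_eq_intros E R refl | simp)+
  have p: "(p has_real_derivative (l - h x - b x * p x) / \<alpha> x) (at x)" for x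
  proof -
    have "(p has_real_derivative l * ((1 - b x * e x) / \<alpha> x) - (h x - b x * r x) / \<alpha> x) (at x)"
      unfolding p_def by (rule derivative_eq_intros e r refl | simp)+
    then show ?thesis by (simp add: p_def diff_divide_distrib add_divide_distrib algebra_simps)
  qed
  have pC: "p \<in> C0_circle"
    using e(1) r(1) by (auto simp: p_def[abs_def] C0_circle_def intro!: continuous_intros)
  have "l * (E 1 - E 0) = R 1 - R 0" using E10 by (simp add: l_def)
  then have "P 1 = P 0" by (simp add: P_def algebra_simps)
  then have "P \<in> C0_circle"
    using antiderivative_in_C0_circle[OF P] C0_circle_periodic[OF pC] by blast
  then show ?thesis using that P p pC unfolding cell_problem_def by blast
qed

section \<open>The principal eigenvalue for small diffusion\<close>

text \<open>Banach's fixed point theorem for the map that sends \<open>q\<close> to the solution of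
  the linear problem with \<open>q\<close> frozen in the quadratic term. The first smallness
  condition on \<epsilon> A keeps the ball of radius \<open>M\<close> invariant, the second makes
  the map a contraction.\<close>

lemma riccati_exists:
  assumes a: "a \<in> C0_circle" "\<And>x. a x > 0" and b: "b \<in> C0_circle" and c: "c \<in> C0_circle"
    and \<beta>: "\<beta> > 0" "(\<forall>x. \<beta> \<le> b x) \<or> (\<forall>x. b x \<le> - \<beta>)"
    and A: "\<And>x. a x \<le> A" and K: "\<And>x. \<bar>c x\<bar> \<le> K"
    and M: "M = 2 * (K + 1) / \<beta>"
    and \<epsilon>: "\<epsilon> > 0" "\<epsilon> * A * M\<^sup>2 \<le> 1" "8 * (\<epsilon> * A * M) \<le> \<beta>"
  obtains l p P where "cell_problem (\<lambda>x. \<epsilon> * a x) b (\<lambda>x. c x + \<epsilon> * a x * (p x)\<^sup>2) l p P"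
    "\<And>x. \<bar>p x\<bar> \<le> M"
proof -
  define \<alpha> where "\<alpha> = (\<lambda>x. \<epsilon> * a x)"
  have \<alpha>: "\<alpha> \<in> C0_circle" "\<And>x. \<alpha> x > 0"
    using a \<epsilon>(1) by (auto simp: \<alpha>_def C0_circle_def intro!: continuous_intros)
  have \<alpha>A: "\<bar>\<alpha> x\<bar> \<le> \<epsilon> * A" for x
    using \<alpha>(2)[of x] A[of x] \<epsilon>(1) by (simp add: \<alpha>_def)
  have b0: "b x \<noteq> 0" for x using \<beta> by (smt (verit))
  have K0: "K \<ge> 0" using K[of 0] by simp
  have M0: "M \<ge> 0" unfolding M using K0 \<beta>(1) by simp
  have A0: "A > 0" using A[of 0] a(2)[of 0] by simp
  define h where "h q = (\<lambda>x. c x + \<alpha> x * (q x)\<^sup>2)" for q :: "real \<Rightarrow> real"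
  \<comment> \<open>Periodicity and the bound are closed conditions since evaluation is continuous
    in the sup metric, so \<open>S\<close> inherits completeness from the bounded continuous
    functions.\<close>
  define S where "S = {q :: real \<Rightarrow>\<^sub>C real. (\<forall>x. q (x + 1) = q x) \<and> (\<forall>x. \<bar>q x\<bar> \<le> M)}"
  have eval: "continuous_on UNIV (\<lambda>q :: real \<Rightarrow>\<^sub>C real. q x)" for x
    unfolding continuous_on_iff using dist_fun_lt_imp_dist_val_lt by blast
  have "closed S"
    unfolding S_def
    by (intro closed_Collect_conj closed_Collect_all closed_Collect_eq closed_Collect_le
        continuous_intros eval)
  note complete = this[folded complete_eq_closed]
  have SC: "apply_bcontfun q \<in> C0_circle" if "q \<in> S" for q
    using that continuous_on_apply_bcontfun[of UNIV q] by (auto simp: S_def C0_circle_def)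
  have SM: "\<bar>q x\<bar> \<le> M" if "q \<in> S" for q x using that by (simp add: S_def)
  have "\<exists>l p P. cell_problem \<alpha> b (h q) l (apply_bcontfun p) P \<and> p \<in> S" if q: "q \<in> S" for q
  proof -
    have "h q \<in> C0_circle"
      using SC[OF q] c \<alpha>(1) unfolding h_def C0_circle_def by (auto intro!: continuous_intros)
    then obtain l p P where sol: "cell_problem \<alpha> b (h q) l p P"
      using cell_problem_exists[OF \<alpha> b b0] by blast
    \<comment> \<open>The quadratic term costs at most 1, which is the extra 1 in the definition of
      \<open>M\<close>.\<close>
    have "\<bar>h q x\<bar> \<le> K + 1" for x
    proof -
      have "\<bar>\<alpha> x * (q x)\<^sup>2\<bar> \<le> \<epsilon> * A * M\<^sup>2"
        unfolding abs_mult using \<alpha>A[of x] SM[OF q, of x] \<epsilon>(1) A0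
        by (intro mult_mono) (auto simp: abs_le_square_iff[symmetric])
      then show ?thesis using K[of x] \<epsilon>(2) unfolding h_def by linarith
    qed
    from cell_problem_bounds(2)[OF sol \<alpha>(2) \<beta>(2,1) this]
    have pM: "\<bar>p x\<bar> \<le> M" for x unfolding M by simp
    have p: "p \<in> C0_circle" using sol by (simp add: cell_problem_def)
    have "p \<in> bcontfun"
      using pM C0_circle_continuous[OF p] by (intro bcontfun_normI[where b = M]) auto
    then have *: "apply_bcontfun (Bcontfun p) = p" by (rule Bcontfun_inverse)
    then have "Bcontfun p \<in> S" using pM p by (simp add: S_def C0_circle_def)
    then show ?thesis using sol * by metis
  qed
  then obtain L T Q where
    T: "\<And>q. q \<in> S \<Longrightarrow> cell_problem \<alpha> b (h q) (L q) (apply_bcontfun (T q)) (Q q)"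
    and TS: "\<And>q. q \<in> S \<Longrightarrow> T q \<in> S"
    by metis
  have "dist (T q) (T r) \<le> 1 / 2 * dist q r" if q: "q \<in> S" and r: "r \<in> S" for q r
  proof -
    have "\<bar>h q x - h r x\<bar> \<le> \<epsilon> * A * (2 * M) * dist q r" for x
    proof -
      have "h q x - h r x = \<alpha> x * ((q x + r x) * (q x - r x))"
        unfolding h_def by (simp add: algebra_simps power2_eq_square)
      also have "\<bar>\<dots>\<bar> \<le> (\<epsilon> * A) * ((2 * M) * dist q r)"
        unfolding abs_mult
        using \<alpha>A[of x] SM[OF q, of x] SM[OF r, of x] \<epsilon>(1) A0 M0 dist_bounded[of q x r]
        by (intro mult_mono) (auto simp: dist_real_def)
      finally show ?thesis by (simp add: mult_ac)
    qed
    from cell_problem_bounds(2)[OF cell_problem_diff[OF T[OF q] T[OF r]] \<alpha>(2) \<beta>(2,1) this]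
    have "\<bar>T q x - T r x\<bar> \<le> 2 * (\<epsilon> * A * (2 * M) * dist q r) / \<beta>" for x by blast
    \<comment> \<open>The 8 in the hypothesis collects a 2 from the bound on solutions, a 2 from
      \<open>\<bar>q x + r x\<bar> \<le> 2 * M\<close>, and a 2 from the contraction
      constant.\<close>
    moreover have "2 * (\<epsilon> * A * (2 * M) * dist q r) / \<beta> \<le> 1 / 2 * dist q r"
    proof -
      have "8 * (\<epsilon> * A * M) * dist q r \<le> \<beta> * dist q r"
        by (rule mult_right_mono[OF \<epsilon>(3)]) simp
      then show ?thesis using \<beta>(1) by (simp add: field_simps)
    qed
    ultimately have "\<bar>T q x - T r x\<bar> \<le> 1 / 2 * dist q r" for x by (rule order_trans)
    then show ?thesis by (intro dist_bound) (simp only: dist_real_def)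
  qed
  moreover have "0 \<in> S" using M0 by (simp add: S_def)
  ultimately have "\<exists>!q\<in>S. T q = q"
    using TS by (intro Banach_fix[OF complete, where c = "1/2"]) auto
  then obtain q where q: "q \<in> S" "T q = q" by blast
  show ?thesis
    using that[of q "L q" "Q q"] T[OF q(1)] q SM[OF q(1)] by (simp add: h_def \<alpha>_def)
qed

section \<open>From the Riccati equation to the principal eigenvalue\<close>

lemma deriv1_of_real:
  assumes "(f has_real_derivative f') (at x)"
  shows "((\<lambda>x. of_real (f x) :: complex) has_vector_derivative of_real f') (at x)"
    and "deriv1 (\<lambda>x. of_real (f x)) x = of_real f'"
proof -
  show *: "((\<lambda>x. of_real (f x) :: complex) has_vector_derivative of_real f') (at x)"
    using assms unfolding has_real_derivative_iff_has_vector_derivative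
    by (rule bounded_linear.has_vector_derivative[OF bounded_linear_of_real])
  show "deriv1 (\<lambda>x. of_real (f x)) x = of_real f'"
    unfolding deriv1_def by (rule vector_derivative_at[OF *])
qed

text \<open>The product rule contributes \<open>(p x)\<^sup>2 * exp (P x)\<close>, which cancels the
  quadratic term of the Riccati equation. Only the linear eigenvalue equation for
  \<open>exp P\<close> remains.\<close>

lemma riccati_exp_derivatives:
  assumes sol: "cell_problem (\<lambda>x. \<epsilon> * a x) b (\<lambda>x. c x + \<epsilon> * a x * (p x)\<^sup>2) l p P"
    and pos: "\<And>x. \<epsilon> * a x > 0"
  shows "((\<lambda>x. exp (P x)) has_real_derivative p x * exp (P x)) (at x)"
    and "((\<lambda>x. p x * exp (P x)) has_real_derivative
      (l - c x - b x * p x) / (\<epsilon> * a x) * exp (P x)) (at x)"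
proof -
  have p: "(p has_real_derivative (l - (c x + \<epsilon> * a x * (p x)\<^sup>2) - b x * p x) / (\<epsilon> * a x)) (at x)"
    and P: "(P has_real_derivative p x) (at x)"
    using sol by (auto simp: cell_problem_def)
  show "((\<lambda>x. exp (P x)) has_real_derivative p x * exp (P x)) (at x)"
    by (rule derivative_eq_intros P refl | simp)+
  have "((\<lambda>x. p x * exp (P x)) has_real_derivative
      (l - (c x + \<epsilon> * a x * (p x)\<^sup>2) - b x * p x) / (\<epsilon> * a x) * exp (P x)
        + p x * (exp (P x) * p x)) (at x)"
    by (rule derivative_eq_intros P p refl | simp)+
  moreover have "(l - (c x + \<epsilon> * a x * (p x)\<^sup>2) - b x * p x) / (\<epsilon> * a x) * exp (P x)
        + p x * (exp (P x) * p x) = (l - c x - b x * p x) / (\<epsilon> * a x) * exp (P x)"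
  proof -
    have "(l - (c x + t * y\<^sup>2) - z) / t * e + y * (e * y) = (l - c x - z) / t * e"
      if "t > 0" for t y z e
      using that by (simp add: field_simps power2_eq_square)
    then show ?thesis using pos .
  qed
  ultimately show "((\<lambda>x. p x * exp (P x)) has_real_derivative
      (l - c x - b x * p x) / (\<epsilon> * a x) * exp (P x)) (at x)" by simp
qed

lemma riccati_eigenvalue:
  assumes sol: "cell_problem (\<lambda>x. \<epsilon> * a x) b (\<lambda>x. c x + \<epsilon> * a x * (p x)\<^sup>2) l p P"
    and a: "a \<in> C0_circle" and b: "b \<in> C0_circle" and c: "c \<in> C0_circle"
    and pos: "\<And>x. \<epsilon> * a x > 0"
  shows "is_eigenvalue a b c \<epsilon> (of_real l)"
proof -
  define u :: "real \<Rightarrow> complex" where "u x = of_real (exp (P x))" for x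
  have P: "P \<in> C0_circle" and p: "p \<in> C0_circle"
    using sol by (auto simp: cell_problem_def)
  note d1 = deriv1_of_real[OF riccati_exp_derivatives(1)[OF sol pos], folded u_def]
  note d2 = deriv1_of_real[OF riccati_exp_derivatives(2)[OF sol pos]]
  have u1: "deriv1 u = (\<lambda>x. of_real (p x * exp (P x)))" using d1(2) by auto
  have u2: "deriv1 (deriv1 u) = (\<lambda>x. of_real ((l - c x - b x * p x) / (\<epsilon> * a x) * exp (P x)))"
    unfolding u1 using d2(2) by auto
  have a0: "\<epsilon> * a x \<noteq> 0" for x using pos[of x] by (metis less_irrefl)
  have "u \<in> C2_circle"
    unfolding C2_circle_def
  proof (intro CollectI conjI allI)
    show "u \<in> C0_circle"
      using P by (auto simp: u_def[abs_def] C0_circle_def intro!: continuous_intros)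
    show "u differentiable at x" for x
      using d1(1)[of x] by (metis differentiableI_vector)
    show "deriv1 u differentiable at x" for x
      unfolding u1 using d2(1)[of x] by (metis differentiableI_vector)
    show "continuous_on UNIV (deriv1 (deriv1 u))"
      unfolding u2 using a0
      by (intro continuous_intros C0_circle_continuous a b c p P) auto
  qed
  moreover have "\<exists>x. u x \<noteq> 0" by (simp add: u_def)
  moreover have "circle_op a b c \<epsilon> u x = of_real l * u x" for x
  proof -
    \<comment> \<open>The eigenvalue equation for \<open>exp P\<close> is checked over the reals and
      only then embedded into the complex numbers.\<close>
    have "(\<epsilon> * a x) * ((l - c x - b x * p x) / (\<epsilon> * a x) * exp (P x)) + b x * (p x * exp (P x))
      + c x * exp (P x) = (l - c x - b x * p x) * exp (P x) + b x * (p x * exp (P x)) + c x * exp (P x)"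
      using a0[of x] by simp
    also have "\<dots> = l * exp (P x)" by (simp add: algebra_simps)
    finally have "(\<epsilon> * a x) * ((l - c x - b x * p x) / (\<epsilon> * a x) * exp (P x))
      + b x * (p x * exp (P x)) + c x * exp (P x) = l * exp (P x)" .
    then have "complex_of_real ((\<epsilon> * a x) * ((l - c x - b x * p x) / (\<epsilon> * a x) * exp (P x))
      + b x * (p x * exp (P x)) + c x * exp (P x)) = of_real (l * exp (P x))" by (rule arg_cong)
    then show ?thesis
      unfolding circle_op_def u2 unfolding u1 u_def of_real_add of_real_mult[of "\<epsilon> * a x"]
        of_real_mult[of "b x"] of_real_mult[of "c x"] of_real_mult[of l] .
  qed
  ultimately show ?thesis unfolding is_eigenvalue_def by blast
qed

text \<open>With \<open>N\<close> the maximum of \<open>|u| / exp P\<close> and a rotation \<open>\<theta>\<close> making \<open>u\<close> positive at the maximal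
  point, \<open>N exp P - Re (\<theta> u)\<close> is nonnegative and vanishes there.\<close>

lemma eigenvalue_Re_le:
  assumes sol: "cell_problem (\<lambda>x. \<epsilon> * a x) b (\<lambda>x. c x + \<epsilon> * a x * (p x)\<^sup>2) l p P"
    and pos: "\<And>x. \<epsilon> * a x > 0"
    and m: "is_eigenvalue a b c \<epsilon> m"
  shows "Re m \<le> l"
proof -
  obtain u where u: "u \<in> C2_circle" "\<exists>x. u x \<noteq> 0" "\<And>x. circle_op a b c \<epsilon> u x = m * u x"
    using m unfolding is_eigenvalue_def by blast
  have uC: "u \<in> C0_circle" using u(1) by (simp add: C2_circle_def)
  have u1: "(u has_vector_derivative deriv1 u x) (at x)" for x
    using u(1) by (simp add: C2_circle_def deriv1_def vector_derivative_works[symmetric])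
  have u2: "(deriv1 u has_vector_derivative deriv1 (deriv1 u) x) (at x)" for x
    using u(1) by (simp add: C2_circle_def deriv1_def[of "deriv1 u"] vector_derivative_works[symmetric])
  have P: "P \<in> C0_circle" using sol by (simp add: cell_problem_def)
  have "(\<lambda>x. norm (u x) / exp (P x)) \<in> C0_circle"
    using uC P by (auto simp: C0_circle_def intro!: continuous_intros)
  then obtain x0 where x0: "\<And>x. norm (u x) / exp (P x) \<le> norm (u x0) / exp (P x0)"
    using C0_circle_attains_sup by blast
  define N where "N = norm (u x0) / exp (P x0)"
  have N: "norm (u x) \<le> N * exp (P x)" for x
    using x0[of x] by (simp add: N_def[symmetric] field_simps)
  have N0: "norm (u x0) = N * exp (P x0)" by (simp add: N_def)
  obtain y where "u y \<noteq> 0" using u(2) by blast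
  then have "0 < N * exp (P y)" using N[of y] by (metis less_le_trans zero_less_norm_iff)
  then have Npos: "N > 0" by (simp add: zero_less_mult_iff)
  then have "u x0 \<noteq> 0" using N0 by auto
  define \<theta> where "\<theta> = cnj (u x0) / of_real (norm (u x0))"
  have \<theta>: "norm \<theta> = 1" using \<open>u x0 \<noteq> 0\<close> by (simp add: \<theta>_def norm_divide)
  have "cnj (u x0) * u x0 = of_real (norm (u x0)) * of_real (norm (u x0))"
    by (metis complex_norm_square mult.commute of_real_power power2_eq_square)
  then have \<theta>u: "\<theta> * u x0 = of_real (N * exp (P x0))"
    using \<open>u x0 \<noteq> 0\<close> by (simp add: \<theta>_def N0[symmetric] field_simps)
  define G where "G x = N * exp (P x) - Re (\<theta> * u x)" for x
  define G1 where "G1 x = N * (p x * exp (P x)) - Re (\<theta> * deriv1 u x)" for x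
  define D where "D = N * ((l - c x0 - b x0 * p x0) / (\<epsilon> * a x0) * exp (P x0))
    - Re (\<theta> * deriv1 (deriv1 u) x0)"
  have re: "((\<lambda>x. Re (\<theta> * v x)) has_real_derivative Re (\<theta> * v')) (at x)"
    if "(v has_vector_derivative v') (at x)" for v v' x
    unfolding has_real_derivative_iff_has_vector_derivative
    using bounded_linear.has_vector_derivative[OF bounded_linear_Re
        bounded_linear.has_vector_derivative[OF bounded_linear_mult_right that]] .
  have dG: "(G has_real_derivative G1 x) (at x)" for x
    unfolding G_def G1_def
    by (intro DERIV_diff DERIV_cmult riccati_exp_derivatives[OF sol pos] re u1)
  have dG1: "(G1 has_real_derivative D) (at x0)"
    unfolding G1_def D_def
    by (intro DERIV_diff DERIV_cmult riccati_exp_derivatives[OF sol pos] re u2)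
  have "G x0 = 0" by (simp add: G_def \<theta>u)
  moreover have "G x \<ge> 0" for x
    using complex_Re_le_cmod[of "\<theta> * u x"] N[of x] by (simp add: G_def norm_mult \<theta>)
  ultimately have min: "G x0 \<le> G x" for x by simp
  \<comment> \<open>At the contact point the values and first derivatives of \<open>N exp P\<close>
    and \<open>Re (\<theta> u)\<close> agree and the second derivatives are ordered. Comparing the
    two equations there leaves only \<open>Re m\<close> against \<open>l\<close>.\<close>
  have "G1 x0 = 0" by (rule derivative_at_min[OF dG min])
  then have r1: "Re (\<theta> * deriv1 u x0) = N * (p x0 * exp (P x0))" by (simp add: G1_def)
  have r0: "Re (\<theta> * u x0) = N * exp (P x0)" by (simp add: \<theta>u)
  have "D \<ge> 0" by (rule second_derivative_at_min[OF dG dG1 min])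
  then have "(\<epsilon> * a x0) * D \<ge> 0" using pos[of x0] by simp
  then have "(\<epsilon> * a x0) * Re (\<theta> * deriv1 (deriv1 u) x0)
      \<le> (\<epsilon> * a x0) * (N * ((l - c x0 - b x0 * p x0) / (\<epsilon> * a x0) * exp (P x0)))"
    by (simp add: D_def right_diff_distrib)
  also have "\<dots> = N * ((l - c x0 - b x0 * p x0) * exp (P x0))"
  proof -
    have "\<epsilon> * a x0 \<noteq> 0" using pos[of x0] by (metis less_irrefl)
    moreover have "t * (N * (y / t * e)) = N * (y * e)" if "t \<noteq> 0" for t y e :: real
      using that by simp
    ultimately show ?thesis by blast
  qed
  finally have le: "(\<epsilon> * a x0) * Re (\<theta> * deriv1 (deriv1 u) x0)
      \<le> N * ((l - c x0 - b x0 * p x0) * exp (P x0))" .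
  have "\<theta> * circle_op a b c \<epsilon> u x0 = m * (\<theta> * u x0)" by (simp add: u(3))
  also have "\<theta> * circle_op a b c \<epsilon> u x0 = of_real (\<epsilon> * a x0) * (\<theta> * deriv1 (deriv1 u) x0)
      + of_real (b x0) * (\<theta> * deriv1 u x0) + of_real (c x0) * (\<theta> * u x0)"
    by (simp add: circle_op_def algebra_simps)
  \<comment> \<open>The coefficients are real and \<open>\<theta> * u x0\<close> is real, so
    \<open>m\<close> enters through its real part only.\<close>
  finally have "Re (of_real (\<epsilon> * a x0) * (\<theta> * deriv1 (deriv1 u) x0)
      + of_real (b x0) * (\<theta> * deriv1 u x0) + of_real (c x0) * (\<theta> * u x0))
      = Re (m * of_real (N * exp (P x0)))" unfolding \<theta>u by (rule arg_cong)
  moreover have "Re (of_real r * z) = r * Re z" "Re (z * of_real r) = Re z * r" for r z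
    by simp_all
  ultimately have "(\<epsilon> * a x0) * Re (\<theta> * deriv1 (deriv1 u) x0) + b x0 * Re (\<theta> * deriv1 u x0)
      + c x0 * Re (\<theta> * u x0) = Re m * (N * exp (P x0))"
    by (simp only: plus_complex.sel)
  then have "Re m * (N * exp (P x0)) \<le> N * ((l - c x0 - b x0 * p x0) * exp (P x0))
      + b x0 * (N * (p x0 * exp (P x0))) + c x0 * (N * exp (P x0))"
    using le unfolding r1 r0 by linarith
  also have "\<dots> = l * (N * exp (P x0))" by (simp add: algebra_simps)
  finally show ?thesis using Npos by simp
qed

lemma riccati_principal_eigenvalue:
  assumes sol: "cell_problem (\<lambda>x. \<epsilon> * a x) b (\<lambda>x. c x + \<epsilon> * a x * (p x)\<^sup>2) l p P"
    and "a \<in> C0_circle" "b \<in> C0_circle" "c \<in> C0_circle"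
    and pos: "\<And>x. \<epsilon> * a x > 0"
  shows "principal_eigenvalue a b c \<epsilon> = l"
  unfolding principal_eigenvalue_def
proof (rule the_equality)
  show "is_eigenvalue a b c \<epsilon> (of_real l) \<and> (\<forall>m. is_eigenvalue a b c \<epsilon> m \<longrightarrow> Re m \<le> l)"
    using riccati_eigenvalue[OF assms] eigenvalue_Re_le[OF sol pos] by blast
next
  fix r assume r: "is_eigenvalue a b c \<epsilon> (of_real r) \<and> (\<forall>m. is_eigenvalue a b c \<epsilon> m \<longrightarrow> Re m \<le> r)"
  \<comment> \<open>Both \<open>r\<close> and \<open>l\<close> are eigenvalues, so each bounds the
    other.\<close>
  then show "r = l"
    using riccati_eigenvalue[OF assms] eigenvalue_Re_le[OF sol pos] by fastforce
qed

section \<open>The vanishing diffusion limit\<close>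

text \<open>The approximant is the moving average of \<open>k\<close> over a short window.\<close>

lemma C1_approximation_mean_zero:
  fixes k :: "real \<Rightarrow> real"
  assumes K: "\<And>x. (K has_real_derivative k x) (at x)" and k: "k \<in> C0_circle" and K01: "K 1 = K 0"
    and \<delta>: "\<delta> > 0"
  obtains g g' G where "g \<in> C0_circle" "g' \<in> C0_circle" "G \<in> C0_circle"
    "\<And>x. (G has_real_derivative g x) (at x)" "\<And>x. (g has_real_derivative g' x) (at x)"
    "\<And>x. \<bar>g x - k x\<bar> \<le> \<delta>"
proof -
  have KC: "K \<in> C0_circle"
    using antiderivative_in_C0_circle[OF K] C0_circle_periodic[OF k] K01 by blast
  obtain Q where Q: "\<And>x. (Q has_real_derivative K x) (at x)"
    using antiderivative_UNIV[OF C0_circle_continuous[OF KC]] by blast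
  \<comment> \<open>Windows of length below 1 that start in the fundamental domain stay inside
    \<open>{0..2}\<close>.\<close>
  have "uniformly_continuous_on {0..2} k"
    using C0_circle_continuous[OF k] by (intro compact_uniformly_continuous) auto
  then obtain d where d: "d > 0"
    "\<And>x y. x \<in> {0..2} \<Longrightarrow> y \<in> {0..2} \<Longrightarrow> dist y x < d \<Longrightarrow> dist (k y) (k x) < \<delta>"
    using \<delta> unfolding uniformly_continuous_on_def by metis
  define \<eta> where "\<eta> = min d 1 / 2"
  have \<eta>: "\<eta> > 0" "\<eta> < d" "\<eta> < 1" using d(1) by (auto simp: \<eta>_def)
  define g where "g = (\<lambda>x. (K (x + \<eta>) - K x) / \<eta>)"
  define g' where "g' = (\<lambda>x. (k (x + \<eta>) - k x) / \<eta>)"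
  define G where "G = (\<lambda>x. (Q (x + \<eta>) - Q x) / \<eta>)"
  have shift: "((\<lambda>x. F (x + \<eta>)) has_real_derivative f (x + \<eta>)) (at x)"
    if "\<And>x. (F has_real_derivative f x) (at x)" for F f x
    using that[of "x + \<eta>"] DERIV_shift[of F] by blast
  have G: "(G has_real_derivative g x) (at x)" for x
    unfolding G_def g_def by (intro DERIV_cdivide DERIV_diff shift Q)
  have g: "(g has_real_derivative g' x) (at x)" for x
    unfolding g_def g'_def by (intro DERIV_cdivide DERIV_diff shift K)
  have per: "f (x + 1 + \<eta>) = f (x + \<eta>)" if "f \<in> C0_circle" for f :: "real \<Rightarrow> real" and x
    using C0_circle_periodic[OF that, of "x + \<eta>"] by (simp add: add_ac)
  have diffq: "(\<lambda>x. (f (x + \<eta>) - f x) / \<eta>) \<in> C0_circle" if "f \<in> C0_circle" for f :: "real \<Rightarrow> real"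
  proof -
    have "continuous_on UNIV (\<lambda>x. f (x + \<eta>))"
      by (rule continuous_on_compose2[OF C0_circle_continuous[OF that]]) (auto intro!: continuous_intros)
    then show ?thesis
      using \<eta>(1) per[OF that] C0_circle_periodic[OF that] C0_circle_continuous[OF that]
      by (auto simp: C0_circle_def intro!: continuous_intros)
  qed
  have gC: "g \<in> C0_circle" and g'C: "g' \<in> C0_circle"
    unfolding g_def g'_def by (intro diffq KC k)+
  \<comment> \<open>\<open>Q\<close> itself may fail to be periodic, but its increment over a period
    is constant and cancels in the difference quotient \<open>G\<close>.\<close>
  have "Q (0 + \<eta> + 1) - Q (0 + \<eta>) = Q 1 - Q 0"
    by (rule periodic_antiderivative[OF Q C0_circle_periodic[OF KC]])
  then have "G 1 = G 0" by (simp add: G_def add_ac)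
  then have GC: "G \<in> C0_circle"
    using antiderivative_in_C0_circle[OF G] C0_circle_periodic[OF gC] by blast
  have near: "\<bar>g x - k x\<bar> \<le> \<delta>" if x: "0 \<le> x" "x < 1" for x
  proof -
    \<comment> \<open>The average over the window is a value of \<open>k\<close> inside the
      window.\<close>
    obtain z where z: "x < z" "z < x + \<eta>" "K (x + \<eta>) - K x = (x + \<eta> - x) * k z"
      using MVT2[of x "x + \<eta>" K k] K \<eta>(1) by auto
    then have "g x = k z" using \<eta>(1) by (simp add: g_def)
    moreover have "dist (k z) (k x) < \<delta>"
      using x z \<eta> by (intro d(2)) (auto simp: dist_real_def)
    ultimately show ?thesis by (simp add: dist_real_def)
  qed
  have "\<bar>g x - k x\<bar> \<le> \<delta>" for x
    using near[of "frac x"] frac_lt_1[of x] by (simp add: C0_circle_frac gC k)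
  then show ?thesis using that gC g'C GC G g by blast
qed

text \<open>The formal limit \<open>k\<close> of \<open>p\<close> is merely continuous and cannot be
  inserted into the equation, so \<open>p\<close> is compared with a smooth mean-zero approximant
  \<open>g\<close>. The a priori bound on the difference gives an error of order \<epsilon> plus a
  multiple of the approximation error.\<close>

lemma principal_eigenvalue_tendsto:
  assumes a: "a \<in> C0_circle" "\<And>x. a x > 0" and b: "b \<in> C0_circle" "\<And>x. b x \<noteq> 0"
    and c: "c \<in> C0_circle"
    and F: "\<And>x. (F has_real_derivative c x / b x) (at x)"
    and R: "\<And>x. (R has_real_derivative 1 / b x) (at x)"
  shows "(principal_eigenvalue a b c \<longlongrightarrow> (F 1 - F 0) / (R 1 - R 0)) (at_right 0)"
proof -
  define l0 where "l0 = (F 1 - F 0) / (R 1 - R 0)"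
  obtain z where "R 1 - R 0 = (1 - 0) * (1 / b z)"
    using MVT2[of 0 1 R "\<lambda>x. 1 / b x"] R by auto
  then have R10: "R 1 - R 0 \<noteq> 0" using b(2)[of z] by auto
  obtain \<beta> where \<beta>: "\<beta> > 0" "(\<forall>x. \<beta> \<le> b x) \<or> (\<forall>x. b x \<le> - \<beta>)"
    using C0_circle_sign[OF b] by blast
  obtain A where A: "A > 0" "\<And>x. \<bar>a x\<bar> \<le> A" using C0_circle_bounded[OF a(1)] by blast
  obtain B where B: "B > 0" "\<And>x. \<bar>b x\<bar> \<le> B" using C0_circle_bounded[OF b(1)] by blast
  obtain K where K: "K > 0" "\<And>x. \<bar>c x\<bar> \<le> K" using C0_circle_bounded[OF c] by blast
  define M where "M = 2 * (K + 1) / \<beta>"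
  \<comment> \<open>This is what the Riccati equation leaves at \<epsilon> = 0; \<open>l0\<close> is
    the constant for which \<open>k\<close> has mean zero, recorded below as
    \<open>W 1 = W 0\<close>.\<close>
  define k where "k = (\<lambda>x. (l0 - c x) / b x)"
  define W where "W x = l0 * R x - F x" for x
  have kC: "k \<in> C0_circle"
    using b c by (auto simp: k_def C0_circle_def intro!: continuous_intros)
  have W: "(W has_real_derivative k x) (at x)" for x
  proof -
    have "(W has_real_derivative l0 * (1 / b x) - c x / b x) (at x)"
      unfolding W_def by (intro DERIV_diff DERIV_cmult F R)
    then show ?thesis by (simp add: k_def diff_divide_distrib)
  qed
  have "l0 * (R 1 - R 0) = F 1 - F 0" using R10 by (simp add: l0_def)
  then have W01: "W 1 = W 0" by (simp add: W_def algebra_simps)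
  have "(principal_eigenvalue a b c \<longlongrightarrow> l0) (at_right 0)"
  proof (rule tendstoI)
    fix e :: real assume e: "e > 0"
    define \<delta> where "\<delta> = e / (2 * B)"
    have "\<delta> > 0" using e B by (simp add: \<delta>_def)
    obtain g g' G where gC: "g \<in> C0_circle" and g'C: "g' \<in> C0_circle" and GC: "G \<in> C0_circle"
      and G: "\<And>x. (G has_real_derivative g x) (at x)"
      and g: "\<And>x. (g has_real_derivative g' x) (at x)"
      and near: "\<And>x. \<bar>g x - k x\<bar> \<le> \<delta>"
      using C1_approximation_mean_zero[OF W kC W01 \<open>\<delta> > 0\<close>] by blast
    obtain N where N: "N > 0" "\<And>x. \<bar>g' x\<bar> \<le> N" using C0_circle_bounded[OF g'C] by blast
    have small: "\<forall>\<^sub>F \<epsilon> in at_right 0. \<epsilon> * C < D" if "D > 0" for C D :: real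
    proof -
      have "((\<lambda>\<epsilon>. \<epsilon> * C) \<longlongrightarrow> 0 * C) (at_right 0)" by (intro tendsto_intros)
      then show ?thesis using that by (intro order_tendstoD(2)) auto
    qed
    have "\<forall>\<^sub>F \<epsilon>::real in at_right 0. \<epsilon> > 0" by (simp add: eventually_at_right_less)
    \<comment> \<open>The first three conditions feed \<open>riccati_exists\<close>; the last makes
      the diffusive error less than half of \<open>e\<close>, the other half going to
      \<open>B * \<delta>\<close>.\<close>
    then have "\<forall>\<^sub>F \<epsilon> in at_right 0. \<epsilon> > 0 \<and> \<epsilon> * (A * M\<^sup>2) < 1 \<and> \<epsilon> * (8 * A * M) < \<beta>
      \<and> \<epsilon> * (A * (M\<^sup>2 + N)) < e / 2"
      using \<beta>(1) e by (intro eventually_conj small) auto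
    then show "\<forall>\<^sub>F \<epsilon> in at_right 0. dist (principal_eigenvalue a b c \<epsilon>) l0 < e"
    proof eventually_elim
      case (elim \<epsilon>)
      have aA: "a x \<le> A" for x using A(2)[of x] by simp
      have pos: "\<epsilon> * a x > 0" for x using elim a(2) by simp
      have \<epsilon>: "\<epsilon> > 0" "\<epsilon> * A * M\<^sup>2 \<le> 1" "8 * (\<epsilon> * A * M) \<le> \<beta>"
        using elim by (auto simp: mult_ac)
      obtain l p P where
        sol: "cell_problem (\<lambda>x. \<epsilon> * a x) b (\<lambda>x. c x + \<epsilon> * a x * (p x)\<^sup>2) l p P"
        and pM: "\<And>x. \<bar>p x\<bar> \<le> M"
        by (rule riccati_exists[OF a b(1) c \<beta> aA K(2) M_def \<epsilon>]) (rule that)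
      \<comment> \<open>\<open>g\<close> solves a cell problem with constant 0 once the right-hand
        side is read off from \<open>g\<close> itself.\<close>
      have "cell_problem (\<lambda>x. \<epsilon> * a x) b (\<lambda>x. - (\<epsilon> * a x * g' x + b x * g x)) 0 g G"
        unfolding cell_problem_def
      proof (intro conjI allI GC gC G)
        fix x
        show "(g has_real_derivative (0 - - (\<epsilon> * a x * g' x + b x * g x) - b x * g x) / (\<epsilon> * a x)) (at x)"
          using g[of x] pos[of x] by (simp add: zero_less_mult_iff) (metis less_irrefl nonzero_mult_div_cancel_left)
      qed
      from cell_problem_diff[OF sol this]
      have diff: "cell_problem (\<lambda>x. \<epsilon> * a x) b
        (\<lambda>x. c x + \<epsilon> * a x * (p x)\<^sup>2 + (\<epsilon> * a x * g' x + b x * g x)) l (\<lambda>x. p x - g x) (\<lambda>x. P x - G x)"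
        by (simp only: diff_0_right diff_minus_eq_add)
      \<comment> \<open>Replacing \<open>c\<close> by \<open>l0 - b k\<close> moves
        \<open>l0\<close> into the constant and leaves a right-hand side that is uniformly
        small.\<close>
      have "cell_problem (\<lambda>x. \<epsilon> * a x) b
        (\<lambda>x. \<epsilon> * a x * ((p x)\<^sup>2 + g' x) + b x * (g x - k x)) (l - l0) (\<lambda>x. p x - g x) (\<lambda>x. P x - G x)"
      proof -
        have eq: "l - (c x + \<epsilon> * a x * (p x)\<^sup>2 + (\<epsilon> * a x * g' x + b x * g x))
          = l - l0 - (\<epsilon> * a x * ((p x)\<^sup>2 + g' x) + b x * (g x - k x))" for x
        proof -
          have "b x * k x = l0 - c x" using b(2)[of x] by (simp add: k_def)
          then show ?thesis by (simp add: algebra_simps)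
        qed
        show ?thesis using diff unfolding cell_problem_def eq .
      qed
      moreover have "\<bar>\<epsilon> * a x * ((p x)\<^sup>2 + g' x) + b x * (g x - k x)\<bar> \<le> \<epsilon> * A * (M\<^sup>2 + N) + B * \<delta>" for x
      proof -
        have "(p x)\<^sup>2 \<le> M\<^sup>2" using pM[of x] by (simp add: abs_le_square_iff[symmetric])
        then have "\<bar>(p x)\<^sup>2 + g' x\<bar> \<le> M\<^sup>2 + N" using N(2)[of x] zero_le_power2[of "p x"] by linarith
        then have "\<bar>\<epsilon> * a x * ((p x)\<^sup>2 + g' x)\<bar> \<le> \<epsilon> * A * (M\<^sup>2 + N)"
          unfolding abs_mult using A elim by (intro mult_mono) auto
        moreover have "\<bar>b x * (g x - k x)\<bar> \<le> B * \<delta>"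
          unfolding abs_mult using B near by (intro mult_mono) auto
        ultimately show ?thesis by linarith
      qed
      ultimately have "\<bar>l - l0\<bar> \<le> \<epsilon> * A * (M\<^sup>2 + N) + B * \<delta>"
        by (rule cell_problem_bounds(1)[OF _ pos \<beta>(2,1)])
      also have "\<dots> < e"
      proof -
        have "B * \<delta> = e / 2" using B(1) by (simp add: \<delta>_def)
        moreover have "\<epsilon> * A * (M\<^sup>2 + N) < e / 2" using elim by (simp only: mult.assoc)
        ultimately show ?thesis by linarith
      qed
      finally show ?case
        using riccati_principal_eigenvalue[OF sol a(1) b(1) c pos] by (simp add: dist_real_def)
    qed
  qed
  then show ?thesis by (simp add: l0_def)
qed

section \<open>The limit as an integral against the density \<open>omega b\<close>\<close>

lemma omega_properties:
  assumes b: "b \<in> C0_circle" "\<And>x. b x \<noteq> 0"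
  shows continuous_omega: "continuous_on S (omega b)"
    and omega_nonneg: "omega b x \<ge> 0"
    and integral_omega: "(LBINT x:{0..1}. omega b x) = 1"
proof -
  have cont: "continuous_on UNIV (\<lambda>x. 1 / b x)"
    using b(2) by (intro continuous_intros C0_circle_continuous b) auto
  obtain R where R: "\<And>x. (R has_real_derivative 1 / b x) (at x)"
    using antiderivative_UNIV[OF cont] by blast
  have int: "(LBINT x:{0..1}. 1 / b x) = R 1 - R 0"
    unfolding set_lebesgue_integral_def
    using R cont by (intro integral_FTC_atLeastAtMost)
      (auto simp: has_real_derivative_iff_has_vector_derivative
        intro: has_vector_derivative_at_within continuous_on_subset)
  \<comment> \<open>The normalising integral is a value of \<open>1 / b\<close>. It is therefore
    nonzero and has the sign of \<open>b\<close>, which gives nonnegativity for negative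
    \<open>b\<close> as well.\<close>
  obtain z where "R 1 - R 0 = (1 - 0) * (1 / b z)"
    using MVT2[of 0 1 R "\<lambda>x. 1 / b x"] R by auto
  then have R10: "R 1 - R 0 = 1 / b z" by simp
  show "continuous_on S (omega b)"
    unfolding omega_def[abs_def] int R10
    using b(2) by (intro continuous_intros C0_circle_continuous b) auto
  obtain \<beta> where \<beta>: "\<beta> > 0" "(\<forall>x. \<beta> \<le> b x) \<or> (\<forall>x. b x \<le> - \<beta>)"
    using C0_circle_sign[OF b] by blast
  have "b z / b x \<ge> 0"
    using \<beta> by (smt (verit) divide_nonneg_nonneg divide_nonpos_nonpos)
  then show "omega b x \<ge> 0" unfolding omega_def int R10 by simp
  show "(LBINT x:{0..1}. omega b x) = 1"
    unfolding omega_def set_integral_divide_zero int R10 using b(2)[of z] by simp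
qed

text \<open>Bridges the closed interval of the fundamental theorem of calculus and the half-open
  fundamental domain; they differ by a null set.\<close>

lemma LBINT_Icc_eq_Ico: "(LBINT x:{0..1}. f x) = (LBINT x:{0..<1::real}. f x :: real)"
  by (rule set_integral_discrete_difference[where X = "{1}"]) auto

lemma Lambda_eq:
  assumes a: "a \<in> C0_circle" "\<And>x. a x > 0" and b: "b \<in> C0_circle" "\<And>x. b x \<noteq> 0"
    and c: "c \<in> C0_circle"
  shows "Lambda a b c = (LBINT x:{0..<1}. omega b x * c x)"
proof -
  have cont: "continuous_on UNIV (\<lambda>x. c x / b x)" "continuous_on UNIV (\<lambda>x. 1 / b x)"
    using b(2) by (intro continuous_intros C0_circle_continuous b c; simp)+
  obtain F where F: "\<And>x. (F has_real_derivative c x / b x) (at x)"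
    using antiderivative_UNIV[OF cont(1)] by blast
  obtain R where R: "\<And>x. (R has_real_derivative 1 / b x) (at x)"
    using antiderivative_UNIV[OF cont(2)] by blast
  have ftc: "(LBINT x:{0..1}. f x) = H 1 - H 0"
    if "\<And>x. (H has_real_derivative f x) (at x)" "continuous_on UNIV f" for H f :: "real \<Rightarrow> real"
    unfolding set_lebesgue_integral_def
    using that by (intro integral_FTC_atLeastAtMost)
      (auto simp: has_real_derivative_iff_has_vector_derivative
        intro: has_vector_derivative_at_within continuous_on_subset)
  have "Lambda a b c = (F 1 - F 0) / (R 1 - R 0)"
    unfolding Lambda_def
    by (rule tendsto_Lim[OF _ principal_eigenvalue_tendsto[OF a b c F R]]) simp
  also have "\<dots> = (LBINT x:{0..1}. c x / b x) / (LBINT x:{0..1}. 1 / b x)"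
    using ftc[OF F cont(1)] ftc[OF R cont(2)] by simp
  also have "\<dots> = (LBINT x:{0..1}. omega b x * c x)"
    unfolding omega_def set_integral_divide_zero[symmetric]
    by (intro set_lebesgue_integral_cong) auto
  finally show ?thesis by (simp add: LBINT_Icc_eq_Ico)
qed

section \<open>Measures on the circle\<close>

lemma space_prob_measure_circle: "prob_measure_circle \<mu> \<Longrightarrow> space \<mu> = {0..<1}"
  by (auto simp: prob_measure_circle_def space_restrict_space dest: sets_eq_imp_space_eq)

lemma borel_measurable_prob_measure_circle:
  assumes "prob_measure_circle \<mu>"
  shows "borel_measurable \<mu> = borel_measurable (restrict_space borel {0..<1})"
  using assms by (intro measurable_cong_sets) (simp_all add: prob_measure_circle_def)

lemma C0_circle_measurable:
  fixes c :: "real \<Rightarrow> real"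
  assumes "prob_measure_circle \<mu>" "c \<in> C0_circle"
  shows "c \<in> borel_measurable \<mu>"
  unfolding borel_measurable_prob_measure_circle[OF assms(1)]
  using C0_circle_continuous[OF assms(2)]
  by (intro measurable_restrict_space1 borel_measurable_continuous_onI)

lemma sets_omega_measure: "sets (omega_measure b) = sets (restrict_space borel {0..<1})"
  by (simp add: omega_measure_def cong: sets_restrict_space_cong)

lemma integral_omega_measure:
  fixes c :: "real \<Rightarrow> real"
  assumes b: "b \<in> C0_circle" "\<And>x. b x \<noteq> 0" and c: "c \<in> C0_circle"
  shows "(\<integral>x. c x \<partial>omega_measure b) = (LBINT x:{0..<1}. omega b x * c x)"
proof -
  have meas: "f \<in> borel_measurable (restrict_space lborel {0..<1})"
    if "continuous_on UNIV f" for f :: "real \<Rightarrow> real"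
    using borel_measurable_continuous_onI[OF that]
    by (intro measurable_restrict_space1) simp
  have "(\<integral>x. c x \<partial>omega_measure b) = (\<integral>x. omega b x *\<^sub>R c x \<partial>restrict_space lborel {0..<1})"
    unfolding omega_measure_def
    by (intro integral_density meas continuous_omega[OF b] C0_circle_continuous[OF c])
      (simp add: omega_nonneg[OF b])
  also have "\<dots> = (LBINT x:{0..<1}. omega b x * c x)"
    by (subst integral_restrict_space) (auto simp: set_lebesgue_integral_def)
  finally show ?thesis .
qed

lemma prob_measure_omega:
  assumes b: "b \<in> C0_circle" "\<And>x. b x \<noteq> 0"
  shows "prob_measure_circle (omega_measure b)"
proof -
  have [measurable]: "omega b \<in> borel_measurable borel"
    by (rule borel_measurable_continuous_onI[OF continuous_omega[OF b]])
  have "emeasure (omega_measure b) (space (omega_measure b))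
      = (\<integral>\<^sup>+ x. ennreal (omega b x) \<partial>restrict_space lborel {0..<1})"
    unfolding omega_measure_def space_density
    by (subst emeasure_density)
      (auto intro!: nn_integral_cong measurable_restrict_space1 simp: indicator_def sets_restrict_space_iff)
  \<comment> \<open>Adding the null point 1 makes the domain compact, which yields integrability of
    the continuous density.\<close>
  also have "\<dots> = (\<integral>\<^sup>+ x. ennreal (indicator {0..1} x *\<^sub>R omega b x) \<partial>lborel)"
    by (subst nn_integral_restrict_space)
      (auto intro!: nn_integral_cong_AE AE_I[where N = "{1}"] simp: indicator_def of_bool_def split: if_splits)
  also have "\<dots> = ennreal (LBINT x:{0..1}. omega b x)"
    unfolding set_lebesgue_integral_def
    using borel_integrable_compact[of "{0..1::real}" "omega b"] continuous_omega[OF b] omega_nonneg[OF b]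
    by (intro nn_integral_eq_integral) (auto simp: indicator_def if_distrib cong: if_cong)
  finally have "prob_space (omega_measure b)"
    by (intro prob_spaceI) (simp add: integral_omega[OF b])
  then show ?thesis
    by (simp add: prob_measure_circle_def sets_omega_measure)
qed

text \<open>The midpoint of the arc \<open>{x<..<1}\<close> is \<open>(x + 1) / 2\<close>. The cosine, being continuous on the
  circle, yields continuous periodic functions that converge to the indicator of the arc.\<close>

lemma cos_gt_iff_in_arc:
  fixes x y :: real
  assumes x: "0 \<le> x" "x < 1" and y: "0 \<le> y" "y < 1"
  shows "cos (2 * pi * (y - (x + 1) / 2)) > cos (pi * (1 - x)) \<longleftrightarrow> x < y"
proof -
  define t where "t = 2 * pi * \<bar>y - (x + 1) / 2\<bar>"
  have t0: "t \<ge> 0" by (simp add: t_def)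
  have "\<bar>y - (x + 1) / 2\<bar> \<le> (x + 1) / 2"
    using x y by (auto simp: abs_le_iff field_simps)
  then have "t \<le> 2 * pi * ((x + 1) / 2)"
    unfolding t_def by (intro mult_left_mono) auto
  then have t1: "t \<le> 2 * pi - pi * (1 - x)" by (simp add: algebra_simps)
  have w: "0 \<le> pi * (1 - x)" "pi * (1 - x) \<le> pi" using x by auto
  have "cos (2 * pi * \<bar>z\<bar>) = cos (2 * pi * z)" for z :: real by (simp add: abs_if)
  then have "cos (2 * pi * (y - (x + 1) / 2)) = cos t" unfolding t_def by (rule sym)
  also have "cos t > cos (pi * (1 - x)) \<longleftrightarrow> t < pi * (1 - x)"
  \<comment> \<open>Cosine is strictly decreasing on \<open>{0..pi}\<close>. Beyond
    \<open>pi\<close>, the reflection \<open>2 * pi - t\<close> falls in that interval and, by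
    \<open>t1\<close>, still lies at or above the threshold angle.\<close>
  proof (cases "t \<le> pi")
    case True
    then show ?thesis using t0 w by (rule_tac cos_mono_less_eq) auto
  next
    case False
    have "cos t = cos (2 * pi - t)" by (simp add: cos_diff)
    also have "\<dots> \<le> cos (pi * (1 - x))"
      using False t1 w by (intro cos_monotone_0_pi_le) auto
    finally have "cos t \<le> cos (pi * (1 - x))" .
    moreover have "\<not> t < pi * (1 - x)" using False w by linarith
    ultimately show ?thesis by simp
  qed
  also have "t < pi * (1 - x) \<longleftrightarrow> 2 * \<bar>y - (x + 1) / 2\<bar> < 1 - x"
    by (simp add: t_def mult.assoc mult.left_commute[of 2 pi])
  also have "\<dots> \<longleftrightarrow> x < y" using x y by (auto simp: abs_if field_simps)
  finally show ?thesis .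
qed

text \<open>The excess of the cosine over its threshold is positive exactly on the arc. Scaling its
  positive part by \<open>n\<close> and truncating at 1 gives pointwise convergence to the
  indicator, and dominated convergence applies with bound 1.\<close>

lemma measure_arc_limit:
  assumes \<mu>: "prob_measure_circle \<mu>" and x: "0 \<le> x" "x < 1"
  defines "f n y \<equiv> min 1 (real n * max 0 (cos (2 * pi * (y - (x + 1) / 2)) - cos (pi * (1 - x))))"
  shows "f n \<in> C0_circle"
    and "(\<lambda>n. \<integral>y. f n y \<partial>\<mu>) \<longlonglongrightarrow> measure \<mu> {x<..<1}"
proof -
  interpret prob_space \<mu> using \<mu> by (simp add: prob_measure_circle_def)
  show C: "f n \<in> C0_circle" for n
  proof -
    have "cos (2 * pi * (y + 1 - (x + 1) / 2)) = cos (2 * pi * (y - (x + 1) / 2))" for y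
    proof -
      have "2 * pi * (y + 1 - (x + 1) / 2) = 2 * pi * (y - (x + 1) / 2) + 2 * pi"
        by (simp add: algebra_simps)
      then show ?thesis by (simp only: cos_periodic)
    qed
    then show ?thesis
      unfolding C0_circle_def f_def by (auto intro!: continuous_intros)
  qed
  have sp: "space \<mu> = {0..<1}" by (rule space_prob_measure_circle[OF \<mu>])
  have ms: "{x<..<1} \<in> sets \<mu>"
    using \<mu> x by (auto simp: prob_measure_circle_def sets_restrict_space_iff)
  have "(\<lambda>n. \<integral>y. f n y \<partial>\<mu>) \<longlonglongrightarrow> (\<integral>y. indicator {x<..<1} y \<partial>\<mu>)"
  proof (rule integral_dominated_convergence[where w = "\<lambda>_. 1"])
    show "AE y in \<mu>. (\<lambda>n. f n y) \<longlonglongrightarrow> indicator {x<..<1} y"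
    proof (rule AE_I2)
      fix y assume "y \<in> space \<mu>"
      then have y: "0 \<le> y" "y < 1" using sp by auto
      define d where "d = cos (2 * pi * (y - (x + 1) / 2)) - cos (pi * (1 - x))"
      show "(\<lambda>n. f n y) \<longlonglongrightarrow> indicator {x<..<1} y"
      proof (cases "x < y")
        case True
        then have d: "d > 0" using cos_gt_iff_in_arc[OF x y] by (simp add: d_def)
        obtain N where N: "1 < real N * d" using reals_Archimedean3[OF d] by blast
        have "f n y = 1" if "n \<ge> N" for n
        proof -
          have "real N * d \<le> real n * d" using that d by (intro mult_right_mono) auto
          then have "1 < real n * d" using N by linarith
          then show ?thesis using d unfolding f_def d_def[symmetric] by simp
        qed
        then have "(\<lambda>n. f n y) \<longlonglongrightarrow> 1"
          by (intro tendsto_eventually eventually_sequentiallyI)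
        then show ?thesis using True y by simp
      next
        case False
        then have "d \<le> 0" using cos_gt_iff_in_arc[OF x y] by (simp add: d_def)
        then have "f n y = 0" for n unfolding f_def d_def[symmetric] by simp
        then show ?thesis using False by simp
      qed
    qed
    show "AE y in \<mu>. norm (f n y) \<le> 1" for n
      by (auto simp: f_def intro!: AE_I2)
    show "f n \<in> borel_measurable \<mu>" for n by (rule C0_circle_measurable[OF \<mu> C])
    show "indicator {x<..<1} \<in> borel_measurable \<mu>" using ms by simp
  qed simp
  also have "(\<integral>y. indicator {x<..<1} y \<partial>\<mu>) = measure \<mu> {x<..<1}"
    using ms sets.sets_into_space[OF ms] by (simp add: Int_absorb2 emeasure_eq_measure)
  finally show "(\<lambda>n. \<integral>y. f n y \<partial>\<mu>) \<longlonglongrightarrow> measure \<mu> {x<..<1}" .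
qed

text \<open>A measure on the fundamental domain is determined by its distribution function, hence by
  the masses of the arcs \<open>{x<..<1}\<close>. These arcs are open in the circle, so continuous
  periodic functions detect their masses.\<close>

lemma circle_measure_eqI:
  assumes \<mu>: "prob_measure_circle \<mu>" and \<nu>: "prob_measure_circle \<nu>"
    and eq: "\<And>c :: real \<Rightarrow> real. c \<in> C0_circle \<Longrightarrow> (\<integral>x. c x \<partial>\<mu>) = (\<integral>x. c x \<partial>\<nu>)"
  shows "\<mu> = \<nu>"
proof -
  \<comment> \<open>Pushing forward along the inclusion into the line makes the uniqueness theorem
    for distribution functions applicable.\<close>
  define L where "L \<kappa> = distr \<kappa> borel (\<lambda>x. x)" for \<kappa> :: "real measure"
  have id: "(\<lambda>x. x) \<in> borel_measurable \<kappa>" if "prob_measure_circle \<kappa>" for \<kappa>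
    using borel_measurable_prob_measure_circle[OF that] measurable_restrict_space1[of "\<lambda>x. x" borel borel]
    by auto
  have rd: "real_distribution (L \<kappa>)" if "prob_measure_circle \<kappa>" for \<kappa>
  proof -
    have "prob_space (L \<kappa>)"
      unfolding L_def using that id[OF that]
      by (intro prob_space.prob_space_distr) (auto simp: prob_measure_circle_def)
    then show ?thesis
      by (simp add: real_distribution_def real_distribution_axioms_def L_def)
  qed
  have cdf: "cdf (L \<kappa>) x = (if x < 0 then 0 else if x < 1 then 1 - measure \<kappa> {x<..<1} else 1)"
    if \<kappa>: "prob_measure_circle \<kappa>" for \<kappa> x
  proof -
    interpret prob_space \<kappa> using \<kappa> by (simp add: prob_measure_circle_def)
    have sp: "space \<kappa> = {0..<1}" by (rule space_prob_measure_circle[OF \<kappa>])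
    have "cdf (L \<kappa>) x = measure \<kappa> ({..x} \<inter> {0..<1})"
      using id[OF \<kappa>] by (simp add: cdf_def L_def measure_distr sp)
    moreover have "{..x} \<inter> {0..<1} = {}" if "x < 0" using that by auto
    moreover have "{..x} \<inter> {0..<1} = space \<kappa>" if "x \<ge> 1" using that sp by auto
    moreover have "measure \<kappa> ({..x} \<inter> {0..<1}) = 1 - measure \<kappa> {x<..<1}" if "0 \<le> x" "x < 1"
    proof -
      have "{x<..<1} \<in> sets \<kappa>"
        using \<kappa> that by (auto simp: prob_measure_circle_def sets_restrict_space_iff)
      moreover have "{..x} \<inter> {0..<1} = space \<kappa> - {x<..<1}" using that sp by auto
      ultimately show ?thesis by (simp add: prob_compl)
    qed
    ultimately show ?thesis by (simp add: prob_space)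
  qed
  have "measure \<mu> {x<..<1} = measure \<nu> {x<..<1}" if "0 \<le> x" "x < 1" for x
    using measure_arc_limit(2)[OF \<mu> that]
    unfolding eq[OF measure_arc_limit(1)[OF \<mu> that]]
    by (rule LIMSEQ_unique[OF _ measure_arc_limit(2)[OF \<nu> that]])
  then have "cdf (L \<mu>) = cdf (L \<nu>)" by (auto simp: fun_eq_iff cdf[OF \<mu>] cdf[OF \<nu>])
  then have L: "L \<mu> = L \<nu>" by (rule cdf_unique[OF rd[OF \<mu>] rd[OF \<nu>]])
  have em: "emeasure \<kappa> A = emeasure (L \<kappa>) A"
    if \<kappa>: "prob_measure_circle \<kappa>" and A: "A \<in> sets \<kappa>" for \<kappa> A
  proof -
    have "A \<in> sets borel" "A \<subseteq> {0..<1}"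
      using \<kappa> A by (auto simp: prob_measure_circle_def sets_restrict_space_iff)
    then show ?thesis
      using id[OF \<kappa>] by (simp add: L_def emeasure_distr space_prob_measure_circle[OF \<kappa>] Int_absorb2)
  qed
  have sets: "sets \<mu> = sets \<nu>" using \<mu> \<nu> by (simp add: prob_measure_circle_def)
  then show ?thesis
    using em[OF \<mu>] em[OF \<nu>] L by (intro measure_eqI) auto
qed

section \<open>Evaluation of the supremum\<close>

theorem proposition3p3:
  fixes a b :: "real \<Rightarrow> real" and \<mu> :: "real measure"
  assumes "a \<in> C0_circle" and "b \<in> C0_circle"
    and "\<And>x. a x > 0"
    and "\<And>x. b x \<noteq> 0"
    and "prob_measure_circle \<mu>"
  shows "J a b \<mu> = (if \<mu> = omega_measure b then 0 else \<infinity>)"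
proof -
  have Lam: "Lambda a b c = (\<integral>x. c x \<partial>omega_measure b)" if "c \<in> C0_circle" for c
    using Lambda_eq[of a b c] integral_omega_measure[of b c] assms that by simp
  \<comment> \<open>Ensures a nonempty index set, so that the supremum of the constant 0 is
    0.\<close>
  have zero: "(\<lambda>x. 0 :: real) \<in> C0_circle" by (simp add: C0_circle_def)
  show ?thesis
  proof (cases "\<mu> = omega_measure b")
    case True
    have "J a b \<mu> = (SUP c \<in> (C0_circle :: (real \<Rightarrow> real) set). 0)"
      unfolding J_def by (rule SUP_cong) (simp_all add: Lam True)
    also have "\<dots> = 0" using zero by (intro cSUP_const) auto
    finally show ?thesis using True by simp
  next
    case False
    then obtain c :: "real \<Rightarrow> real" where c: "c \<in> C0_circle" "(\<integral>x. c x \<partial>\<mu>) \<noteq> (\<integral>x. c x \<partial>omega_measure b)"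
      using circle_measure_eqI[OF assms(5) prob_measure_omega] assms by blast
    define d where "d = (\<integral>x. c x \<partial>\<mu>) - (\<integral>x. c x \<partial>omega_measure b)"
    have d: "d \<noteq> 0" using c by (simp add: d_def)
    have "ereal B \<le> J a b \<mu>" for B
    proof -
      \<comment> \<open>By linearity, the multiple \<open>B / d\<close> of the separating function
        makes the functional take exactly the value \<open>B\<close>.\<close>
      have sc: "(\<lambda>x. B / d * c x) \<in> C0_circle"
        using c(1) d by (auto simp: C0_circle_def intro!: continuous_intros)
      have "(\<integral>x. B / d * c x \<partial>\<mu>) - Lambda a b (\<lambda>x. B / d * c x) = B / d * d"
        unfolding Lam[OF sc] integral_mult_right_zero unfolding d_def by (simp only: right_diff_distrib)
      then have "ereal B = ereal ((\<integral>x. B / d * c x \<partial>\<mu>) - Lambda a b (\<lambda>x. B / d * c x))"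
        using d by simp
      also have "\<dots> \<le> J a b \<mu>" unfolding J_def by (rule SUP_upper[OF sc])
      finally show ?thesis .
    qed
    then have "J a b \<mu> = \<infinity>" by (rule ereal_top)
    then show ?thesis using False by simp
  qed
qed

end
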